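(* There is a strict $2$-category $\mathsf{C}$ whose nerve $\mathcal{N}_{\mathsf{C}}$ (a simplicial set) cannot be equipped with a compository structure, i.e. there is no family of composition operations $\circ_k$ making $\mathcal{N}_{\mathsf{C}}$ into a compository.
   Context: **Simplicial conventions.** $\mathbb{N}$ includes $0$. $\Delta$ is the category of nonempty finite ordinals $[n]=\{0,\dots,n\}$ and order-preserving maps. A simplicial set is a functor $\mathcal{C}:\Delta^{\mathrm{op}}\to\mathbf{Set}$; write $\mathcal{C}(n)=\mathcal{C}([n])$, and for $f:[m]\to[n]$ and $A\in\mathcal{C}(n)$ write $Af:=\mathcal{C}(f)(A)\in\mathcal{C}(m)$. The map $\partial_k:[n-1]\to[n]$ is the injective order-preserving map omitting $k$; $\eta_k:[n+1]\to[n]$ is the surjective order-preserving map hitting $k$ twice. For $k\le n$, $s_k:[k]\to[n]$ is $v\mapsto v$ and $t_k:[k]\to[n]$ is $v\mapsto v+n-k$; the codomain index $n$ is left implicit. **Compositories.** A pair $(A,B)\in\mathcal{C}(m)\times\mathcal{C}(n)$ is $k$-composable ($k\le m,n$) if $At_k=Bs_k$. A compository is a simplicial set $\mathcal{C}$ with an element $A\circ_k B\in\mathcal{C}(m+n-k)$ for every $k\in\mathbb{N}$ and every $k$-composable pair $(A,B)\in\mathcal{C}(m)\times\mathcal{C}(n)$, such that: 1. (Identity) $As_k\circ_k A=A$ and $A\circ_k At_k=A$. And for every $k$-composable $(A,B)\in\mathcal{C}(m)\times\mathcal{C}(n)$: 2. (Back-and-forth) $(A\circ_k B)s_{m+i}\circ_{k+i}B=A\circ_k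 B$ for $0\le i\le n-k$; $A\circ_{k+j}(A\circ_k B)t_{n+j}=A\circ_k B$ for $0\le j\le m-k$. 3. (Degeneracies) $(A\circ_k B)\eta_i=A\eta_i\circ_k B$ for $i\le m-k$; $(A\circ_k B)\eta_i=A\circ_k B\eta_{i-m+k}$ for $i\ge m$; $(A\circ_k B)\eta_i=A\eta_i\circ_{k+1}B\eta_{i-m+k}$ for $m-k\le i\le m$. 4. (Faces) $(A\circ_k B)\partial_i=A\partial_i\circ_k B$ for $i<m-k$; $(A\circ_k B)\partial_i=A\circ_k B\partial_{i-m+k}$ for $i>m$. **Nerve of a strict 2-category.** An $n$-simplex of $\mathcal{N}_{\mathsf{C}}$ consists of objects $a_i$ ($0\le i\le n$), $1$-morphisms $f_{ij}:a_i\to a_j$ ($i\le j$) and $2$-morphisms $\alpha_{ijk}:f_{jk}f_{ij}\Rightarrow f_{ik}$ ($i\le j\le k$), such that $f_{ii}=\mathrm{id}$, $\alpha_{iij}$ and $\alpha_{ijj}$ are identities, and $\alpha_{ikl}\cdot(f_{kl}\,\alpha_{ijk})=\alpha_{ijl}\cdot(\alpha_{jkl}\,f_{ij})$ for $i\le j\le k\le l$ (where $\cdot$ is vertical composition and juxtaposition is whiskering). An order-preserving map acts by reindexing. *)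

theory Defs
  imports Main "HOL-Library.FuncSet"
begin

section \<open>Simplicial sets\<close>

text \<open>The finite ordinal \<open>[n]\<close> is \<open>{..n}\<close>. A morphism of the simplex category is represented by the
  unique function with that graph which is \<open>undefined\<close> outside its domain.\<close>

definition Delta :: "nat \<Rightarrow> nat \<Rightarrow> (nat \<Rightarrow> nat) set" where
  "Delta m n = {\<phi> \<in> {..m} \<rightarrow>\<^sub>E {..n}. mono_on {..m} \<phi>}"

text \<open>\<open>face_map n k\<close> is used only for \<open>n \<ge> 1\<close>, where its domain \<open>{..<n}\<close> is \<open>[n - 1]\<close>.\<close>

definition face_map :: "nat \<Rightarrow> nat \<Rightarrow> nat \<Rightarrow> nat" where
  "face_map n k = (\<lambda>v\<in>{..<n}. if v < k then v else Suc v)"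

definition degen_map :: "nat \<Rightarrow> nat \<Rightarrow> nat \<Rightarrow> nat" where
  "degen_map n k = (\<lambda>v\<in>{..Suc n}. if v \<le> k then v else v - 1)"

text \<open>The inclusions \<open>s\<^sub>k, t\<^sub>k : [k] \<rightarrow> [n]\<close> of an initial and of a terminal segment; the function
  representing \<open>s\<^sub>k\<close> does not depend on \<open>n\<close>.\<close>

definition init_map :: "nat \<Rightarrow> nat \<Rightarrow> nat" where
  "init_map k = (\<lambda>v\<in>{..k}. v)"

definition term_map :: "nat \<Rightarrow> nat \<Rightarrow> nat \<Rightarrow> nat" where
  "term_map k n = (\<lambda>v\<in>{..k}. v + n - k)"

text \<open>\<open>act X m n \<phi>\<close> is the map from \<open>n\<close>-simplices to \<open>m\<close>-simplices induced by \<open>\<phi> : [m] \<rightarrow> [n]\<close>. Dimensions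
  are explicit because the sets \<open>simplices X n\<close> need not be disjoint.\<close>

record 'x sset =
  simplices :: "nat \<Rightarrow> 'x set"
  act :: "nat \<Rightarrow> nat \<Rightarrow> (nat \<Rightarrow> nat) \<Rightarrow> 'x \<Rightarrow> 'x"

locale simplicial_set =
  fixes X :: "'x sset"
  assumes act_closed:
      "\<phi> \<in> Delta m n \<Longrightarrow> A \<in> simplices X n \<Longrightarrow> act X m n \<phi> A \<in> simplices X m"
    and act_id:
      "A \<in> simplices X n \<Longrightarrow> act X n n (\<lambda>v\<in>{..n}. v) A = A"
    and act_comp:
      "\<phi> \<in> Delta l m \<Longrightarrow> \<psi> \<in> Delta m n \<Longrightarrow> A \<in> simplices X n \<Longrightarrow>
        act X l n (compose {..l} \<psi> \<phi>) A = act X l m \<phi> (act X m n \<psi> A)"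

section \<open>Compositories\<close>

definition composable :: "'x sset \<Rightarrow> nat \<Rightarrow> nat \<Rightarrow> nat \<Rightarrow> 'x \<Rightarrow> 'x \<Rightarrow> bool" where
  "composable X k m n A B \<longleftrightarrow>
     k \<le> m \<and> k \<le> n \<and> A \<in> simplices X m \<and> B \<in> simplices X n \<and>
     act X k m (term_map k m) A = act X k n (init_map k) B"

text \<open>\<open>comp k m n A B\<close> is \<open>A \<circ>\<^sub>k B\<close> for \<open>A\<close> of dimension \<open>m\<close> and \<open>B\<close> of dimension \<open>n\<close>. Values on pairs that
  are not composable are irrelevant: given the face and identity axioms, every composite occurring
  below is one of a composable pair. The upper bounds \<open>i \<le> m + n - k\<close> are those needed for
  the degeneracy or face of the composite to exist.\<close>

locale compository = simplicial_set X
  for X :: "'x sset" +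
  fixes comp :: "nat \<Rightarrow> nat \<Rightarrow> nat \<Rightarrow> 'x \<Rightarrow> 'x \<Rightarrow> 'x"
  assumes comp_closed:
      "composable X k m n A B \<Longrightarrow> comp k m n A B \<in> simplices X (m + n - k)"
    and identity_left:
      "A \<in> simplices X n \<Longrightarrow> k \<le> n \<Longrightarrow> comp k k n (act X k n (init_map k) A) A = A"
    and identity_right:
      "A \<in> simplices X n \<Longrightarrow> k \<le> n \<Longrightarrow> comp k n k A (act X k n (term_map k n) A) = A"
    and back_and_forth_left:
      "composable X k m n A B \<Longrightarrow> i \<le> n - k \<Longrightarrow>
        comp (k + i) (m + i) n
          (act X (m + i) (m + n - k) (init_map (m + i)) (comp k m n A B)) B
        = comp k m n A B"
    and back_and_forth_right:
      "composable X k m n A B \<Longrightarrow> j \<le> m - k \<Longrightarrow>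
        comp (k + j) m (n + j)
          A (act X (n + j) (m + n - k) (term_map (n + j) (m + n - k)) (comp k m n A B))
        = comp k m n A B"
    and degeneracy_left:
      "composable X k m n A B \<Longrightarrow> i \<le> m - k \<Longrightarrow>
        act X (Suc (m + n - k)) (m + n - k) (degen_map (m + n - k) i) (comp k m n A B)
        = comp k (Suc m) n (act X (Suc m) m (degen_map m i) A) B"
    and degeneracy_right:
      "composable X k m n A B \<Longrightarrow> m \<le> i \<Longrightarrow> i \<le> m + n - k \<Longrightarrow>
        act X (Suc (m + n - k)) (m + n - k) (degen_map (m + n - k) i) (comp k m n A B)
        = comp k m (Suc n) A (act X (Suc n) n (degen_map n (i + k - m)) B)"
    and degeneracy_middle:
      "composable X k m n A B \<Longrightarrow> m - k \<le> i \<Longrightarrow> i \<le> m \<Longrightarrow>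
        act X (Suc (m + n - k)) (m + n - k) (degen_map (m + n - k) i) (comp k m n A B)
        = comp (Suc k) (Suc m) (Suc n)
            (act X (Suc m) m (degen_map m i) A)
            (act X (Suc n) n (degen_map n (i + k - m)) B)"
    and face_left:
      "composable X k m n A B \<Longrightarrow> i < m - k \<Longrightarrow>
        act X (m + n - k - 1) (m + n - k) (face_map (m + n - k) i) (comp k m n A B)
        = comp k (m - 1) n (act X (m - 1) m (face_map m i) A) B"
    and face_right:
      "composable X k m n A B \<Longrightarrow> m < i \<Longrightarrow> i \<le> m + n - k \<Longrightarrow>
        act X (m + n - k - 1) (m + n - k) (face_map (m + n - k) i) (comp k m n A B)
        = comp k m (n - 1) A (act X (n - 1) n (face_map n (i + k - m)) B)"

section \<open>Strict 2-categories\<close>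

text \<open>Composition is written in functional order: \<open>cmp g f\<close> is \<open>g\<close> after \<open>f\<close>.\<close>

locale category =
  fixes Obj :: "'o set"
    and Arr :: "'a set"
    and src trg :: "'a \<Rightarrow> 'o"
    and unit :: "'o \<Rightarrow> 'a"
    and cmp :: "'a \<Rightarrow> 'a \<Rightarrow> 'a"
  assumes src_closed: "f \<in> Arr \<Longrightarrow> src f \<in> Obj"
    and trg_closed: "f \<in> Arr \<Longrightarrow> trg f \<in> Obj"
    and unit_closed: "a \<in> Obj \<Longrightarrow> unit a \<in> Arr"
    and src_unit: "a \<in> Obj \<Longrightarrow> src (unit a) = a"
    and trg_unit: "a \<in> Obj \<Longrightarrow> trg (unit a) = a"
    and cmp_closed: "f \<in> Arr \<Longrightarrow> g \<in> Arr \<Longrightarrow> trg f = src g \<Longrightarrow> cmp g f \<in> Arr"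
    and src_cmp: "f \<in> Arr \<Longrightarrow> g \<in> Arr \<Longrightarrow> trg f = src g \<Longrightarrow> src (cmp g f) = src f"
    and trg_cmp: "f \<in> Arr \<Longrightarrow> g \<in> Arr \<Longrightarrow> trg f = src g \<Longrightarrow> trg (cmp g f) = trg g"
    and cmp_unit: "f \<in> Arr \<Longrightarrow> cmp f (unit (src f)) = f"
    and unit_cmp: "f \<in> Arr \<Longrightarrow> cmp (unit (trg f)) f = f"
    and cmp_assoc:
      "f \<in> Arr \<Longrightarrow> g \<in> Arr \<Longrightarrow> h \<in> Arr \<Longrightarrow> trg f = src g \<Longrightarrow> trg g = src h \<Longrightarrow>
        cmp (cmp h g) f = cmp h (cmp g f)"

record ('o, 'm, 'c) two_cat =
  Ob :: "'o set"
  Mor :: "'m set"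
  Cell :: "'c set"
  src1 :: "'m \<Rightarrow> 'o"
  trg1 :: "'m \<Rightarrow> 'o"
  id1 :: "'o \<Rightarrow> 'm"
  comp1 :: "'m \<Rightarrow> 'm \<Rightarrow> 'm"
  src2 :: "'c \<Rightarrow> 'm"
  trg2 :: "'c \<Rightarrow> 'm"
  id2 :: "'m \<Rightarrow> 'c"
  vcomp :: "'c \<Rightarrow> 'c \<Rightarrow> 'c"
  hcomp :: "'c \<Rightarrow> 'c \<Rightarrow> 'c"

locale strict_two_category =
  one: category "Ob C" "Mor C" "src1 C" "trg1 C" "id1 C" "comp1 C" +
  vert: category "Mor C" "Cell C" "src2 C" "trg2 C" "id2 C" "vcomp C" +
  horiz: category "Ob C" "Cell C"
    "\<lambda>\<alpha>. src1 C (src2 C \<alpha>)" "\<lambda>\<alpha>. trg1 C (src2 C \<alpha>)" "\<lambda>a. id2 C (id1 C a)" "hcomp C"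
  for C :: "('o, 'm, 'c) two_cat" +
  assumes src_parallel: "\<alpha> \<in> Cell C \<Longrightarrow> src1 C (trg2 C \<alpha>) = src1 C (src2 C \<alpha>)"
    and trg_parallel: "\<alpha> \<in> Cell C \<Longrightarrow> trg1 C (trg2 C \<alpha>) = trg1 C (src2 C \<alpha>)"
    and src_hcomp:
      "\<alpha> \<in> Cell C \<Longrightarrow> \<beta> \<in> Cell C \<Longrightarrow> trg1 C (src2 C \<alpha>) = src1 C (src2 C \<beta>) \<Longrightarrow>
        src2 C (hcomp C \<beta> \<alpha>) = comp1 C (src2 C \<beta>) (src2 C \<alpha>)"
    and trg_hcomp:
      "\<alpha> \<in> Cell C \<Longrightarrow> \<beta> \<in> Cell C \<Longrightarrow> trg1 C (src2 C \<alpha>) = src1 C (src2 C \<beta>) \<Longrightarrow>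
        trg2 C (hcomp C \<beta> \<alpha>) = comp1 C (trg2 C \<beta>) (trg2 C \<alpha>)"
    and hcomp_id2:
      "f \<in> Mor C \<Longrightarrow> g \<in> Mor C \<Longrightarrow> trg1 C f = src1 C g \<Longrightarrow>
        hcomp C (id2 C g) (id2 C f) = id2 C (comp1 C g f)"
    and interchange:
      "\<alpha> \<in> Cell C \<Longrightarrow> \<alpha>' \<in> Cell C \<Longrightarrow> \<beta> \<in> Cell C \<Longrightarrow> \<beta>' \<in> Cell C \<Longrightarrow>
        trg2 C \<alpha> = src2 C \<alpha>' \<Longrightarrow> trg2 C \<beta> = src2 C \<beta>' \<Longrightarrow>
        trg1 C (src2 C \<alpha>) = src1 C (src2 C \<beta>) \<Longrightarrow>
        hcomp C (vcomp C \<beta>' \<beta>) (vcomp C \<alpha>' \<alpha>) = vcomp C (hcomp C \<beta>' \<alpha>') (hcomp C \<beta> \<alpha>)"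

definition hom1 :: "('o, 'm, 'c) two_cat \<Rightarrow> 'o \<Rightarrow> 'o \<Rightarrow> 'm set" where
  "hom1 C a b = {f \<in> Mor C. src1 C f = a \<and> trg1 C f = b}"

definition hom2 :: "('o, 'm, 'c) two_cat \<Rightarrow> 'm \<Rightarrow> 'm \<Rightarrow> 'c set" where
  "hom2 C f g = {\<alpha> \<in> Cell C. src2 C \<alpha> = f \<and> trg2 C \<alpha> = g}"

definition lwhisker :: "('o, 'm, 'c) two_cat \<Rightarrow> 'm \<Rightarrow> 'c \<Rightarrow> 'c" where
  "lwhisker C g \<alpha> = hcomp C (id2 C g) \<alpha>"

definition rwhisker :: "('o, 'm, 'c) two_cat \<Rightarrow> 'c \<Rightarrow> 'm \<Rightarrow> 'c" where
  "rwhisker C \<beta> f = hcomp C \<beta> (id2 C f)"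

section \<open>The nerve\<close>

definition idx2 :: "nat \<Rightarrow> (nat \<times> nat) set" where
  "idx2 n = {(i, j). i \<le> j \<and> j \<le> n}"

definition idx3 :: "nat \<Rightarrow> (nat \<times> nat \<times> nat) set" where
  "idx3 n = {(i, j, k). i \<le> j \<and> j \<le> k \<and> k \<le> n}"

record ('o, 'm, 'c) nerve_simplex =
  vtx :: "nat \<Rightarrow> 'o"
  edge :: "nat \<times> nat \<Rightarrow> 'm"
  tri :: "nat \<times> nat \<times> nat \<Rightarrow> 'c"

text \<open>The families are extensional, so that two simplices are equal exactly when they have the same
  data on the index sets.\<close>

definition nerve_simplices ::
    "('o, 'm, 'c) two_cat \<Rightarrow> nat \<Rightarrow> ('o, 'm, 'c) nerve_simplex set" where
  "nerve_simplices C n = {A.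
     vtx A \<in> {..n} \<rightarrow>\<^sub>E Ob C \<and>
     edge A \<in> (\<Pi>\<^sub>E (i, j) \<in> idx2 n. hom1 C (vtx A i) (vtx A j)) \<and>
     tri A \<in> (\<Pi>\<^sub>E (i, j, k) \<in> idx3 n.
                hom2 C (comp1 C (edge A (j, k)) (edge A (i, j))) (edge A (i, k))) \<and>
     (\<forall>i \<le> n. edge A (i, i) = id1 C (vtx A i)) \<and>
     (\<forall>i j. i \<le> j \<and> j \<le> n \<longrightarrow>
        tri A (i, i, j) = id2 C (edge A (i, j)) \<and> tri A (i, j, j) = id2 C (edge A (i, j))) \<and>
     (\<forall>i j k l. i \<le> j \<and> j \<le> k \<and> k \<le> l \<and> l \<le> n \<longrightarrow>
        vcomp C (tri A (i, k, l)) (lwhisker C (edge A (k, l)) (tri A (i, j, k))) =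
        vcomp C (tri A (i, j, l)) (rwhisker C (tri A (j, k, l)) (edge A (i, j))))}"

definition reindex ::
    "nat \<Rightarrow> (nat \<Rightarrow> nat) \<Rightarrow> ('o, 'm, 'c) nerve_simplex \<Rightarrow> ('o, 'm, 'c) nerve_simplex" where
  "reindex m \<phi> A = \<lparr>
     vtx = (\<lambda>i\<in>{..m}. vtx A (\<phi> i)),
     edge = (\<lambda>(i, j)\<in>idx2 m. edge A (\<phi> i, \<phi> j)),
     tri = (\<lambda>(i, j, k)\<in>idx3 m. tri A (\<phi> i, \<phi> j, \<phi> k))\<rparr>"

definition nerve :: "('o, 'm, 'c) two_cat \<Rightarrow> ('o, 'm, 'c) nerve_simplex sset" where
  "nerve C = \<lparr>simplices = nerve_simplices C, act = (\<lambda>m n \<phi> A. reindex m \<phi> A)\<rparr>"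

end

theory Submission imports Defs begin

text \<open>
  The reason is that a compository must glue any two simplices along a common segment, and that this
  is a completion property of 2-cells which a 2-category need not have.

  The face and identity axioms force \<open>A \<circ>\<^sub>k B\<close> to restrict to \<open>A\<close> on its initial segment and
  to \<open>B\<close> on its terminal segment. The lemmas \<open>last_face_comp\<close> and \<open>first_face_comp\<close> show this when the
  segment in question is a face of codimension one. Now let \<open>A\<close> and \<open>B\<close> be triangles in a
  nerve with the last edge of \<open>A\<close> equal to the first edge of \<open>B\<close>. The tetrahedron \<open>A \<circ>\<^sub>1 B\<close> with vertices
  \<open>0, 1, 2, 3\<close> has the prescribed 2-cells \<open>\<alpha>\<^sub>0\<^sub>1\<^sub>2\<close> and \<open>\<alpha>\<^sub>1\<^sub>2\<^sub>3\<close>, and its cocycle condition says that the span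
  \<open>f\<^sub>2\<^sub>3 f\<^sub>0\<^sub>2 \<Leftarrow> f\<^sub>2\<^sub>3 f\<^sub>1\<^sub>2 f\<^sub>0\<^sub>1 \<Rightarrow> f\<^sub>1\<^sub>3 f\<^sub>0\<^sub>1\<close> formed from these extends to a commutative square with
  fourth corner \<open>f\<^sub>0\<^sub>3\<close>. If \<open>f\<^sub>0\<^sub>1\<close> and \<open>f\<^sub>2\<^sub>3\<close> are identities, the span is an arbitrary span of 2-cells
  \<open>d \<Leftarrow> b \<Rightarrow> e\<close>. So if the nerve of a strict 2-category carries a compository structure, every span in
  every hom-category can be completed to a commutative square
  (\<open>compository_nerve_completes_spans\<close>).

  It remains to find a strict 2-category with a span that has no completion. One object suffices:
  a monoid of 1-morphisms with a compatible partial order, in which two elements have a lower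
  bound but no upper bound (\<open>span_two_cat\<close>).
\<close>

section \<open>The nerve is a simplicial set\<close>

lemma Delta_D:
  assumes "\<phi> \<in> Delta m n"
  shows "i \<le> m \<Longrightarrow> \<phi> i \<le> n" and "i \<le> j \<Longrightarrow> j \<le> m \<Longrightarrow> \<phi> i \<le> \<phi> j"
  using assms by (auto simp: Delta_def mono_on_def PiE_iff)

text \<open>The next two rules unpack the dependent function spaces over the index sets, so that simplices
  can be treated index by index.\<close>

lemma nerve_simplicesI:
  assumes "vtx A \<in> extensional {..n}" "edge A \<in> extensional (idx2 n)" "tri A \<in> extensional (idx3 n)"
    and "\<And>i. i \<le> n \<Longrightarrow> vtx A i \<in> Ob C"
    and "\<And>i j. i \<le> j \<Longrightarrow> j \<le> n \<Longrightarrow> edge A (i, j) \<in> hom1 C (vtx A i) (vtx A j)"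
    and "\<And>i j k. i \<le> j \<Longrightarrow> j \<le> k \<Longrightarrow> k \<le> n \<Longrightarrow>
      tri A (i, j, k) \<in> hom2 C (comp1 C (edge A (j, k)) (edge A (i, j))) (edge A (i, k))"
    and "\<And>i. i \<le> n \<Longrightarrow> edge A (i, i) = id1 C (vtx A i)"
    and "\<And>i j. i \<le> j \<Longrightarrow> j \<le> n \<Longrightarrow> tri A (i, i, j) = id2 C (edge A (i, j))"
    and "\<And>i j. i \<le> j \<Longrightarrow> j \<le> n \<Longrightarrow> tri A (i, j, j) = id2 C (edge A (i, j))"
    and "\<And>i j k l. i \<le> j \<Longrightarrow> j \<le> k \<Longrightarrow> k \<le> l \<Longrightarrow> l \<le> n \<Longrightarrow>
        vcomp C (tri A (i, k, l)) (lwhisker C (edge A (k, l)) (tri A (i, j, k))) =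
        vcomp C (tri A (i, j, l)) (rwhisker C (tri A (j, k, l)) (edge A (i, j)))"
  shows "A \<in> nerve_simplices C n"
proof -
  have "vtx A \<in> {..n} \<rightarrow>\<^sub>E Ob C"
    using assms(1,4) by (auto simp: PiE_iff)
  moreover have "edge A \<in> (\<Pi>\<^sub>E (i, j) \<in> idx2 n. hom1 C (vtx A i) (vtx A j))"
    using assms(2,5) by (auto simp: PiE_iff idx2_def)
  moreover have "tri A \<in> (\<Pi>\<^sub>E (i, j, k) \<in> idx3 n.
      hom2 C (comp1 C (edge A (j, k)) (edge A (i, j))) (edge A (i, k)))"
    using assms(3,6) by (auto simp: PiE_iff idx3_def)
  ultimately show ?thesis
    using assms(7-10) by (simp add: nerve_simplices_def)
qed

lemma nerve_simplicesD:
  assumes "A \<in> nerve_simplices C n"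
  shows "vtx A \<in> extensional {..n}" "edge A \<in> extensional (idx2 n)" "tri A \<in> extensional (idx3 n)"
    and "\<And>i. i \<le> n \<Longrightarrow> vtx A i \<in> Ob C"
    and "\<And>i j. i \<le> j \<Longrightarrow> j \<le> n \<Longrightarrow> edge A (i, j) \<in> hom1 C (vtx A i) (vtx A j)"
    and "\<And>i j k. i \<le> j \<Longrightarrow> j \<le> k \<Longrightarrow> k \<le> n \<Longrightarrow>
      tri A (i, j, k) \<in> hom2 C (comp1 C (edge A (j, k)) (edge A (i, j))) (edge A (i, k))"
    and "\<And>i. i \<le> n \<Longrightarrow> edge A (i, i) = id1 C (vtx A i)"
    and "\<And>i j. i \<le> j \<Longrightarrow> j \<le> n \<Longrightarrow> tri A (i, i, j) = id2 C (edge A (i, j))"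
    and "\<And>i j. i \<le> j \<Longrightarrow> j \<le> n \<Longrightarrow> tri A (i, j, j) = id2 C (edge A (i, j))"
    and "\<And>i j k l. i \<le> j \<Longrightarrow> j \<le> k \<Longrightarrow> k \<le> l \<Longrightarrow> l \<le> n \<Longrightarrow>
        vcomp C (tri A (i, k, l)) (lwhisker C (edge A (k, l)) (tri A (i, j, k))) =
        vcomp C (tri A (i, j, l)) (rwhisker C (tri A (j, k, l)) (edge A (i, j)))"
proof -
  note A = assms[unfolded nerve_simplices_def mem_Collect_eq]
  note v = A[THEN conjunct1] and e = A[THEN conjunct2, THEN conjunct1]
    and t = A[THEN conjunct2, THEN conjunct2, THEN conjunct1]
    and laws = A[THEN conjunct2, THEN conjunct2, THEN conjunct2]
  note e_id = laws[THEN conjunct1] and t_id = laws[THEN conjunct2, THEN conjunct1]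
    and cocycle = laws[THEN conjunct2, THEN conjunct2]
  show "vtx A \<in> extensional {..n}" "edge A \<in> extensional (idx2 n)" "tri A \<in> extensional (idx3 n)"
    using v e t by (simp_all only: PiE_iff)
  show "vtx A i \<in> Ob C" if "i \<le> n" for i
    using PiE_mem[OF v, of i] that by simp
  show "edge A (i, j) \<in> hom1 C (vtx A i) (vtx A j)" if "i \<le> j" "j \<le> n" for i j
    using PiE_mem[OF e, of "(i, j)"] that by (simp add: idx2_def)
  show "tri A (i, j, k) \<in> hom2 C (comp1 C (edge A (j, k)) (edge A (i, j))) (edge A (i, k))"
    if "i \<le> j" "j \<le> k" "k \<le> n" for i j k
    using PiE_mem[OF t, of "(i, j, k)"] that by (simp add: idx3_def)
  show "edge A (i, i) = id1 C (vtx A i)" if "i \<le> n" for i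
    using e_id that by simp
  show "tri A (i, i, j) = id2 C (edge A (i, j))" "tri A (i, j, j) = id2 C (edge A (i, j))"
    if "i \<le> j" "j \<le> n" for i j
    using t_id that by simp_all
  show "vcomp C (tri A (i, k, l)) (lwhisker C (edge A (k, l)) (tri A (i, j, k))) =
      vcomp C (tri A (i, j, l)) (rwhisker C (tri A (j, k, l)) (edge A (i, j)))"
    if "i \<le> j" "j \<le> k" "k \<le> l" "l \<le> n" for i j k l
    using cocycle[rule_format, of i j k l] that by simp
qed

lemma reindex_simps:
  "i \<le> m \<Longrightarrow> vtx (reindex m \<phi> A) i = vtx A (\<phi> i)"
  "i \<le> j \<Longrightarrow> j \<le> m \<Longrightarrow> edge (reindex m \<phi> A) (i, j) = edge A (\<phi> i, \<phi> j)"
  "i \<le> j \<Longrightarrow> j \<le> k \<Longrightarrow> k \<le> m \<Longrightarrow> tri (reindex m \<phi> A) (i, j, k) = tri A (\<phi> i, \<phi> j, \<phi> k)"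
  by (auto simp: reindex_def idx2_def idx3_def)

lemma reindex_extensional:
  "vtx (reindex m \<phi> A) \<in> extensional {..m}"
  "edge (reindex m \<phi> A) \<in> extensional (idx2 m)"
  "tri (reindex m \<phi> A) \<in> extensional (idx3 m)"
  by (simp_all add: reindex_def)

lemma simplex_eqI:
  fixes A B :: "('o, 'm, 'c) nerve_simplex"
  assumes "vtx A \<in> extensional {..n}" "edge A \<in> extensional (idx2 n)" "tri A \<in> extensional (idx3 n)"
    and "vtx B \<in> extensional {..n}" "edge B \<in> extensional (idx2 n)" "tri B \<in> extensional (idx3 n)"
    and "\<And>i. i \<le> n \<Longrightarrow> vtx A i = vtx B i"
    and "\<And>i j. i \<le> j \<Longrightarrow> j \<le> n \<Longrightarrow> edge A (i, j) = edge B (i, j)"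
    and "\<And>i j k. i \<le> j \<Longrightarrow> j \<le> k \<Longrightarrow> k \<le> n \<Longrightarrow> tri A (i, j, k) = tri B (i, j, k)"
  shows "A = B"
proof -
  have "vtx A = vtx B" by (rule extensionalityI[OF assms(1,4)]) (use assms(7) in auto)
  moreover have "edge A = edge B"
    by (rule extensionalityI[OF assms(2,5)]) (use assms(8) in \<open>auto simp: idx2_def\<close>)
  moreover have "tri A = tri B"
    by (rule extensionalityI[OF assms(3,6)]) (use assms(9) in \<open>auto simp: idx3_def\<close>)
  ultimately show ?thesis by simp
qed

theorem simplicial_set_nerve:
  fixes C :: "('o, 'm, 'c) two_cat"
  shows "simplicial_set (nerve C)"
proof
  fix \<phi> m n A
  assume \<phi>: "\<phi> \<in> Delta m n" and "A \<in> simplices (nerve C) n"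
  then have A: "A \<in> nerve_simplices C n" by (simp add: nerve_def)
  have "reindex m \<phi> A \<in> nerve_simplices C m"
    by (rule nerve_simplicesI)
      (use Delta_D[OF \<phi>] nerve_simplicesD[OF A] in \<open>simp_all add: reindex_simps reindex_extensional\<close>)
  then show "act (nerve C) m n \<phi> A \<in> simplices (nerve C) m" by (simp add: nerve_def)
next
  fix A n
  assume "A \<in> simplices (nerve C) n"
  then have A: "A \<in> nerve_simplices C n" by (simp add: nerve_def)
  have "reindex n (\<lambda>v\<in>{..n}. v) A = A"
    by (rule simplex_eqI[OF reindex_extensional nerve_simplicesD(1-3)[OF A]])
      (simp_all add: reindex_simps)
  then show "act (nerve C) n n (\<lambda>v\<in>{..n}. v) A = A" by (simp add: nerve_def)
next
  fix \<phi> l m \<psi> n and A :: "('o, 'm, 'c) nerve_simplex"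
  assume \<phi>: "\<phi> \<in> Delta l m"
  have "reindex l (compose {..l} \<psi> \<phi>) A = reindex l \<phi> (reindex m \<psi> A)"
    by (rule simplex_eqI[OF reindex_extensional reindex_extensional])
      (use Delta_D[OF \<phi>] in \<open>simp_all add: reindex_simps compose_def\<close>)
  then show "act (nerve C) l n (compose {..l} \<psi> \<phi>) A = act (nerve C) l m \<phi> (act (nerve C) m n \<psi> A)"
    by (simp add: nerve_def)
qed

section \<open>Outer faces of a composite\<close>

text \<open>Dropping the last vertex of \<open>A \<circ>\<^sub>k B\<close> only affects \<open>B\<close>. When \<open>B\<close> has just one vertex beyond
  the overlap, what is left of it is \<open>B s\<^sub>k = A t\<^sub>k\<close>, and \<open>A \<circ>\<^sub>k A t\<^sub>k = A\<close> by the identity axiom.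
  The dual lemma treats the first vertex.\<close>

lemma (in compository) last_face_comp:
  assumes "composable X k m (Suc k) A B"
  shows "act X m (Suc m) (face_map (Suc m) (Suc m)) (comp k m (Suc k) A B) = A"
proof -
  have "face_map (Suc k) (Suc k) = init_map k"
    by (auto simp: face_map_def init_map_def)
  moreover have km: "k \<le> m" "A \<in> simplices X m"
    and "act X k m (term_map k m) A = act X k (Suc k) (init_map k) B"
    using assms by (auto simp: composable_def)
  ultimately show ?thesis
    using face_right[OF assms, of "Suc m"] identity_right[OF km(2,1)] by (simp add: Suc_diff_le)
qed

lemma (in compository) first_face_comp:
  assumes "composable X k (Suc k) n A B"
  shows "act X n (Suc n) (face_map (Suc n) 0) (comp k (Suc k) n A B) = B"
proof -
  have "face_map (Suc k) 0 = term_map k (Suc k)"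
    by (auto simp: face_map_def term_map_def)
  moreover have km: "k \<le> n" "B \<in> simplices X n"
    and "act X k (Suc k) (term_map k (Suc k)) A = act X k n (init_map k) B"
    using assms by (auto simp: composable_def)
  ultimately show ?thesis
    using face_left[OF assms, of 0] identity_left[OF km(2,1)] by simp
qed

section \<open>Completion of spans of 2-cells\<close>

text \<open>The triangle with boundary \<open>f : x \<rightarrow> y\<close>, \<open>g : y \<rightarrow> z\<close>, \<open>h : x \<rightarrow> z\<close> and filling 2-cell
  \<open>\<alpha> : g f \<Rightarrow> h\<close>. All data at repeated indices are the identities that a simplex must have there.\<close>

definition triangle where
  "triangle C x y z f g h \<alpha> =
    (let v = (\<lambda>i::nat. if i = 0 then x else if i = 1 then y else z);
         e = (\<lambda>i j. if i = j then id1 C (v i) else if j = 1 then f else if i = 1 then g else h)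
     in \<lparr>vtx = (\<lambda>i\<in>{..2}. v i), edge = (\<lambda>(i, j)\<in>idx2 2. e i j),
         tri = (\<lambda>(i, j, k)\<in>idx3 2. if i = j \<or> j = k then id2 C (e i k) else \<alpha>)\<rparr>)"

lemma triangle_extensional:
  "vtx (triangle C x y z f g h \<alpha>) \<in> extensional {..2}"
  "edge (triangle C x y z f g h \<alpha>) \<in> extensional (idx2 2)"
  "tri (triangle C x y z f g h \<alpha>) \<in> extensional (idx3 2)"
  by (simp_all add: triangle_def Let_def)

lemma triangle_simps:
  "i \<le> 2 \<Longrightarrow> vtx (triangle C x y z f g h \<alpha>) i = (if i = 0 then x else if i = 1 then y else z)"
  "i \<le> j \<Longrightarrow> j \<le> 2 \<Longrightarrow> edge (triangle C x y z f g h \<alpha>) (i, j) =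
    (if i = j then id1 C (if i = 0 then x else if i = 1 then y else z)
     else if j = 1 then f else if i = 1 then g else h)"
  "i \<le> j \<Longrightarrow> j \<le> k \<Longrightarrow> k \<le> 2 \<Longrightarrow> tri (triangle C x y z f g h \<alpha>) (i, j, k) =
    (if i = j \<or> j = k then id2 C (edge (triangle C x y z f g h \<alpha>) (i, k)) else \<alpha>)"
  by (auto simp: triangle_def Let_def idx2_def idx3_def)

context strict_two_category
begin

lemma id1_in_hom1: "a \<in> Ob C \<Longrightarrow> id1 C a \<in> hom1 C a a"
  by (simp add: hom1_def one.unit_closed one.src_unit one.trg_unit)

lemma comp1_units:
  "f \<in> hom1 C a b \<Longrightarrow> comp1 C f (id1 C a) = f"
  "f \<in> hom1 C a b \<Longrightarrow> comp1 C (id1 C b) f = f"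
  using one.cmp_unit one.unit_cmp by (auto simp: hom1_def)

lemma id2_in_hom2: "f \<in> hom1 C a b \<Longrightarrow> id2 C f \<in> hom2 C f f"
  by (simp add: hom1_def hom2_def vert.unit_closed vert.src_unit vert.trg_unit)

lemma vcomp_units:
  "\<alpha> \<in> hom2 C f g \<Longrightarrow> vcomp C \<alpha> (id2 C f) = \<alpha>"
  "\<alpha> \<in> hom2 C f g \<Longrightarrow> vcomp C (id2 C g) \<alpha> = \<alpha>"
  using vert.cmp_unit vert.unit_cmp by (auto simp: hom2_def)

lemma whisker_units:
  assumes "\<alpha> \<in> hom2 C f g" "f \<in> hom1 C a b"
  shows "lwhisker C (id1 C b) \<alpha> = \<alpha>" "rwhisker C \<alpha> (id1 C a) = \<alpha>"
  using assms horiz.cmp_unit[of \<alpha>] horiz.unit_cmp[of \<alpha>]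
  by (auto simp: hom1_def hom2_def lwhisker_def rwhisker_def)

lemma whisker_id2:
  assumes "f \<in> hom1 C a b" "g \<in> hom1 C b c"
  shows "lwhisker C g (id2 C f) = id2 C (comp1 C g f)" "rwhisker C (id2 C g) f = id2 C (comp1 C g f)"
  using assms hcomp_id2 by (auto simp: hom1_def lwhisker_def rwhisker_def)

lemma comp1_in_hom1: "f \<in> hom1 C a b \<Longrightarrow> g \<in> hom1 C b c \<Longrightarrow> comp1 C g f \<in> hom1 C a c"
  by (auto simp: hom1_def one.cmp_closed one.src_cmp one.trg_cmp)

text \<open>Among four ordered indices from \<open>0, 1, 2\<close> two neighbours coincide, so every instance of the
  cocycle condition is degenerate and follows from the unit laws.\<close>

lemma triangle_in_nerve:
  assumes f: "f \<in> hom1 C x y" and g: "g \<in> hom1 C y z" and h: "h \<in> hom1 C x z"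
    and \<alpha>: "\<alpha> \<in> hom2 C (comp1 C g f) h"
  shows "triangle C x y z f g h \<alpha> \<in> nerve_simplices C 2" (is "?T \<in> _")
proof -
  have ob: "x \<in> Ob C" "y \<in> Ob C" "z \<in> Ob C"
    using f g one.src_closed one.trg_closed by (auto simp: hom1_def)
  have v: "vtx ?T i \<in> Ob C" if "i \<le> 2" for i
    using that ob by (simp add: triangle_simps)
  have e: "edge ?T (i, j) \<in> hom1 C (vtx ?T i) (vtx ?T j)" if "i \<le> j" "j \<le> 2" for i j
  proof -
    have "i = j \<or> i = 0 \<and> j = 1 \<or> i = 1 \<and> j = 2 \<or> i = 0 \<and> j = 2"
      using that by linarith
    then show ?thesis using that f g h ob by (auto simp: triangle_simps id1_in_hom1)
  qed
  have eid: "edge ?T (i, i) = id1 C (vtx ?T i)" if "i \<le> 2" for i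
    using that by (simp add: triangle_simps)
  have tid: "tri ?T (i, i, j) = id2 C (edge ?T (i, j))" "tri ?T (i, j, j) = id2 C (edge ?T (i, j))"
    if "i \<le> j" "j \<le> 2" for i j
    using that by (simp_all add: triangle_simps(3))
  have t: "tri ?T (i, j, k) \<in> hom2 C (comp1 C (edge ?T (j, k)) (edge ?T (i, j))) (edge ?T (i, k))"
    if "i \<le> j" "j \<le> k" "k \<le> 2" for i j k
  proof -
    have "i = j \<or> j = k \<or> i = 0 \<and> j = 1 \<and> k = 2"
      using that by linarith
    then consider "i = j" | "j = k" | "i = 0" "j = 1" "k = 2"
      by blast
    then show ?thesis
    proof cases
      case 3
      then show ?thesis using \<alpha> by (simp add: triangle_simps)
    qed (use that e[of i k] in \<open>simp_all add: eid tid comp1_units id2_in_hom2\<close>)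
  qed
  have "vcomp C (tri ?T (i, k, l)) (lwhisker C (edge ?T (k, l)) (tri ?T (i, j, k))) =
        vcomp C (tri ?T (i, j, l)) (rwhisker C (tri ?T (j, k, l)) (edge ?T (i, j)))"
    if le: "i \<le> j" "j \<le> k" "k \<le> l" "l \<le> 2" for i j k l
  proof -
    have "i = j \<or> j = k \<or> k = l"
      using le by linarith
    then consider "i = j" | "j = k" | "k = l"
      by blast
    then show ?thesis
    proof cases
      case 1
      have jk: "edge ?T (j, k) \<in> hom1 C (vtx ?T j) (vtx ?T k)"
        and kl: "edge ?T (k, l) \<in> hom1 C (vtx ?T k) (vtx ?T l)"
        and jkl: "tri ?T (j, k, l) \<in> hom2 C (comp1 C (edge ?T (k, l)) (edge ?T (j, k))) (edge ?T (j, l))"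
        using le by (intro e t; linarith)+
      have jj: "edge ?T (j, j) = id1 C (vtx ?T j)"
        "tri ?T (j, j, k) = id2 C (edge ?T (j, k))" "tri ?T (j, j, l) = id2 C (edge ?T (j, l))"
        using le by (intro eid tid; linarith)+
      show ?thesis
        unfolding 1 jj whisker_id2(1)[OF jk kl]
          whisker_units(2)[OF jkl comp1_in_hom1[OF jk kl]] vcomp_units[OF jkl] ..
    next
      case 2
      have ij: "edge ?T (i, j) \<in> hom1 C (vtx ?T i) (vtx ?T j)"
        and jl: "edge ?T (j, l) \<in> hom1 C (vtx ?T j) (vtx ?T l)"
        using le by (intro e; linarith)+
      have jj: "tri ?T (i, j, j) = id2 C (edge ?T (i, j))" "tri ?T (j, j, l) = id2 C (edge ?T (j, l))"
        using le by (intro tid; linarith)+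
      show ?thesis
        unfolding 2[symmetric] jj whisker_id2[OF ij jl] ..
    next
      case 3
      have ij: "edge ?T (i, j) \<in> hom1 C (vtx ?T i) (vtx ?T j)"
        and jk: "edge ?T (j, k) \<in> hom1 C (vtx ?T j) (vtx ?T k)"
        and ijk: "tri ?T (i, j, k) \<in> hom2 C (comp1 C (edge ?T (j, k)) (edge ?T (i, j))) (edge ?T (i, k))"
        using le by (intro e t; linarith)+
      have kk: "edge ?T (k, k) = id1 C (vtx ?T k)"
        "tri ?T (i, k, k) = id2 C (edge ?T (i, k))" "tri ?T (j, k, k) = id2 C (edge ?T (j, k))"
        using le 3 by (intro eid tid; linarith)+
      show ?thesis
        unfolding 3[symmetric] kk whisker_id2(2)[OF ij jk]
          whisker_units(1)[OF ijk comp1_in_hom1[OF ij jk]] vcomp_units[OF ijk] ..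
    qed
  qed
  then show ?thesis
    by (intro nerve_simplicesI triangle_extensional v e t eid tid)
qed

text \<open>The tetrahedron that proves this has vertices \<open>x, x, y, y\<close>: padding with the identities of \<open>x\<close>
  and \<open>y\<close> turns \<open>\<phi>\<close> into a triangle ending in the edge \<open>b\<close> and \<open>\<psi>\<close> into a triangle starting with it,
  so that the two can be composed along \<open>b\<close>.\<close>

theorem compository_nerve_completes_spans:
  fixes cp
  assumes "compository (nerve C) cp"
    and b: "b \<in> hom1 C x y" and d: "d \<in> hom1 C x y" and e: "e \<in> hom1 C x y"
    and \<phi>: "\<phi> \<in> hom2 C b d" and \<psi>: "\<psi> \<in> hom2 C b e"
  obtains h \<delta> \<epsilon> where "\<delta> \<in> hom2 C d h" "\<epsilon> \<in> hom2 C e h" "vcomp C \<delta> \<phi> = vcomp C \<epsilon> \<psi>"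
proof -
  interpret N: compository "nerve C" cp by fact
  have x: "x \<in> Ob C" and y: "y \<in> Ob C"
    using b one.src_closed one.trg_closed by (auto simp: hom1_def)
  define A where "A = triangle C x x y (id1 C x) b d \<phi>"
  define B where "B = triangle C x y y b (id1 C y) e \<psi>"
  have A: "A \<in> nerve_simplices C 2" and B: "B \<in> nerve_simplices C 2"
    unfolding A_def B_def using b d e \<phi> \<psi> x y
    by (auto intro!: triangle_in_nerve simp: id1_in_hom1 comp1_units)
  have "reindex 1 (term_map 1 2) A = reindex 1 (init_map 1) B"
    by (rule simplex_eqI[OF reindex_extensional reindex_extensional])
      (auto simp: reindex_simps term_map_def init_map_def A_def B_def triangle_simps)
  with A B have AB: "composable (nerve C) 1 2 2 A B"
    by (simp add: composable_def nerve_def)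
  define X where "X = cp 1 2 2 A B"
  have X: "X \<in> nerve_simplices C 3"
    using N.comp_closed[OF AB] by (simp add: X_def nerve_def)
  have XA: "reindex 2 (face_map 3 3) X = A"
    using N.last_face_comp[of 1 2 A B] AB by (simp add: X_def nerve_def numeral_2_eq_2 numeral_3_eq_3)
  have XB: "reindex 2 (face_map 3 0) X = B"
    using N.first_face_comp[of 1 2 A B] AB by (simp add: X_def nerve_def numeral_2_eq_2 numeral_3_eq_3)
  have XA': "edge X (0, 1) = id1 C x" "edge X (0, 2) = d" "tri X (0, 1, 2) = \<phi>"
    using arg_cong[OF XA, of "\<lambda>S. edge S (0, 1)"] arg_cong[OF XA, of "\<lambda>S. edge S (0, 2)"]
      arg_cong[OF XA, of "\<lambda>S. tri S (0, 1, 2)"]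
    by (simp_all add: A_def reindex_simps triangle_simps face_map_def)
  have XB': "edge X (1, 3) = e" "edge X (2, 3) = id1 C y" "tri X (1, 2, 3) = \<psi>"
    using arg_cong[OF XB, of "\<lambda>S. edge S (0, 2)"] arg_cong[OF XB, of "\<lambda>S. edge S (1, 2)"]
      arg_cong[OF XB, of "\<lambda>S. tri S (0, 1, 2)"]
    by (simp_all add: B_def reindex_simps triangle_simps face_map_def numeral_2_eq_2 numeral_3_eq_3)
  \<comment> \<open>The two 2-cells into the edge \<open>(0, 3)\<close>, which neither \<open>A\<close> nor \<open>B\<close> contains, complete the square.\<close>
  show thesis
  proof
    show "tri X (0, 2, 3) \<in> hom2 C d (edge X (0, 3))"
      using nerve_simplicesD(6)[OF X, of 0 2 3] d by (simp add: XA' XB' comp1_units del: One_nat_def)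
    show "tri X (0, 1, 3) \<in> hom2 C e (edge X (0, 3))"
      using nerve_simplicesD(6)[OF X, of 0 1 3] e by (simp add: XA' XB' comp1_units del: One_nat_def)
    show "vcomp C (tri X (0, 2, 3)) \<phi> = vcomp C (tri X (0, 1, 3)) \<psi>"
      using nerve_simplicesD(10)[OF X, of 0 1 2 3] \<phi> \<psi> b by (simp add: XA' XB' whisker_units del: One_nat_def)
  qed
qed

end

section \<open>A 2-category with a span that has no completion\<close>

definition span_mult :: "nat \<Rightarrow> nat \<Rightarrow> nat" where
  "span_mult y x = (if y = 0 then x else if x = 0 then y else 1)"

text \<open>The monoid of 1-morphisms \<open>{0, 1, 2, 3}\<close>, with unit \<open>0\<close>, is ordered by \<open>\<preceq>\<close>, which has \<open>1 \<preceq> 2\<close> and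
  \<open>1 \<preceq> 3\<close> as its only proper relations. This order is compatible
  with multiplication, since only units compare with the unit and products of non-units are constant.
  A 2-cell is a pair \<open>f \<preceq> g\<close>: the codes \<open>0\<close> to \<open>3\<close> stand for the identities, \<open>4\<close> for \<open>1 \<preceq> 2\<close> and \<open>5\<close>
  for \<open>1 \<preceq> 3\<close>. Since \<open>4\<close> and \<open>5\<close> cannot be composed vertically with each other, one factor of a
  vertical composite is always an identity. A horizontal composite of 2-cells between non-units is
  the identity of \<open>1\<close>, so \<open>span_mult\<close> on codes also computes horizontal composites.\<close>

definition span_two_cat :: "(nat, nat, nat) two_cat" where
  "span_two_cat = \<lparr>Ob = {0}, Mor = {..3}, Cell = {..5},
     src1 = (\<lambda>f. 0), trg1 = (\<lambda>f. 0), id1 = (\<lambda>a. 0), comp1 = span_mult,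
     src2 = (\<lambda>\<alpha>. if \<alpha> \<le> 3 then \<alpha> else 1), trg2 = (\<lambda>\<alpha>. if \<alpha> \<le> 3 then \<alpha> else \<alpha> - 2), id2 = (\<lambda>f. f),
     vcomp = (\<lambda>\<beta> \<alpha>. if \<alpha> \<le> 3 then \<beta> else \<alpha>), hcomp = span_mult\<rparr>"

lemma strict_two_category_span_two_cat: "strict_two_category span_two_cat"
proof (unfold_locales, goal_cases)
  \<comment> \<open>Interchange: no 2-cell links the unit to a non-unit. If the unit occurs on one side, horizontal
      composition returns the other factor; otherwise both sides are the identity of \<open>1\<close>.\<close>
  case (39 \<alpha> \<alpha>' \<beta> \<beta>')
  then have "(if \<alpha> \<le> 3 then \<alpha> else \<alpha> - 2) = (if \<alpha>' \<le> 3 then \<alpha>' else 1)"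
    and "(if \<beta> \<le> 3 then \<beta> else \<beta> - 2) = (if \<beta>' \<le> 3 then \<beta>' else 1)"
    by (simp_all add: span_two_cat_def)
  then have "\<alpha>' = 0 \<longleftrightarrow> \<alpha> = 0" and "\<beta>' = 0 \<longleftrightarrow> \<beta> = 0"
    by presburger+
  then show ?case
    by (cases "\<alpha> = 0"; cases "\<beta> = 0") (simp_all add: span_two_cat_def span_mult_def)
qed (simp_all add: span_two_cat_def span_mult_def, presburger+)

text \<open>The span is \<open>2 \<Leftarrow> 1 \<Rightarrow> 3\<close>; the only 2-cells out of \<open>2\<close> and \<open>3\<close> are identities, so it has no
  completion.\<close>

lemma span_two_cat_not_compository: "\<not> compository (nerve span_two_cat) cp"
proof
  interpret strict_two_category span_two_cat by (rule strict_two_category_span_two_cat)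
  assume "compository (nerve span_two_cat) cp"
  then obtain h \<delta> \<epsilon> where "\<delta> \<in> hom2 span_two_cat 2 h" "\<epsilon> \<in> hom2 span_two_cat 3 h"
    by (rule compository_nerve_completes_spans[of cp 1 0 0 2 3 4 5])
      (auto simp: span_two_cat_def hom1_def hom2_def)
  then show False
    by (auto simp: span_two_cat_def hom2_def split: if_splits)
qed

theorem theorem3p1p3:
  "\<exists>C :: (nat, nat, nat) two_cat.
     strict_two_category C \<and> simplicial_set (nerve C) \<and> \<not> (\<exists>comp. compository (nerve C) comp)"
  using strict_two_category_span_two_cat simplicial_set_nerve span_two_cat_not_compository by blast

end
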